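(* Let $L$ be a finite-dimensional Leibniz algebra over a field $F$ that is not a Lie algebra. Then $L$ cannot be lattice isomorphic to a Lie algebra; that is, if $L^*$ is a finite-dimensional Lie algebra over $F$, then there is no lattice isomorphism from $L$ to $L^*$.
   Context: A (right) Leibniz algebra over a field $F$ is an $F$-vector space $L$ with a bilinear product satisfying $[x,[y,z]]=[[x,y],z]-[[x,z],y]$ for all $x,y,z\in L$. It is a Lie algebra if and only if $[x,x]=0$ for all $x\in L$; it is called non-Lie otherwise. The set $\mathcal{L}(L)$ of all subalgebras of $L$ is a lattice, where $A\cap B$ is the usual intersection and $A\cup B$ denotes the subalgebra generated by the set-theoretic union of $A$ and $B$. A lattice isomorphism from $L$ to $L^*$ is a bijective map $\theta:\mathcal{L}(L)\to\mathcal{L}(L^* )$ such that $\theta(A\cup B)=\theta(A)\cup\theta(B)$ and $\theta(A\cap B)=\theta(A)\cap\theta(B)$ for all $A,B\in\mathcal{L}(L)$. *)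

theory Defs
  imports Complex_Main
begin

locale leibniz_algebra = vector_space scale
  for scale :: "'k::field \<Rightarrow> 'a::ab_group_add \<Rightarrow> 'a" (infixr "*s" 75) +
  fixes bracket :: "'a \<Rightarrow> 'a \<Rightarrow> 'a"
  assumes bracket_add_left: "bracket (x + y) z = bracket x z + bracket y z"
    and bracket_add_right: "bracket x (y + z) = bracket x y + bracket x z"
    and bracket_scale_left: "bracket (c *s x) y = c *s bracket x y"
    and bracket_scale_right: "bracket x (c *s y) = c *s bracket x y"
    and leibniz: "bracket x (bracket y z) = bracket (bracket x y) z - bracket (bracket x z) y"
begin

definition subalgebra :: "'a set \<Rightarrow> bool" where
  "subalgebra A \<longleftrightarrow> subspace A \<and> (\<forall>x\<in>A. \<forall>y\<in>A. bracket x y \<in> A)"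

definition subalgebras :: "'a set set" where
  "subalgebras = {A. subalgebra A}"

definition subalgebra_join :: "'a set \<Rightarrow> 'a set \<Rightarrow> 'a set" where
  "subalgebra_join A B = subalgebra hull (A \<union> B)"

lemma subalgebra_join_closed: "subalgebra (subalgebra_join A B)"
  unfolding subalgebra_join_def
  by (rule hull_in) (auto simp: subalgebra_def intro: subspace_Inter)

lemma subalgebra_Int: "subalgebra A \<Longrightarrow> subalgebra B \<Longrightarrow> subalgebra (A \<inter> B)"
  by (auto simp: subalgebra_def intro: subspace_inter)

end

locale lie_algebra = leibniz_algebra +
  assumes bracket_self: "bracket x x = 0"

lemma (in leibniz_algebra) lie_algebra_iff: "lie_algebra scale bracket \<longleftrightarrow> (\<forall>x. bracket x x = 0)"
  using leibniz_algebra_axioms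
  by (auto simp: lie_algebra_def lie_algebra_axioms_def)

lemma (in lie_algebra) bracket_anticomm: "bracket x y = - bracket y x"
proof -
  have "bracket (x + y) (x + y) = 0" by (rule bracket_self)
  then have "bracket x y + bracket y x = 0"
    unfolding bracket_add_left bracket_add_right by (simp add: bracket_self add.commute)
  then show ?thesis by (simp add: eq_neg_iff_add_eq_0)
qed

lemma (in lie_algebra) jacobi:
  "bracket x (bracket y z) + bracket y (bracket z x) + bracket z (bracket x y) = 0"
proof -
  have neg: "bracket (- u) v = - bracket u v" for u v
    using bracket_scale_left[of "-1" u v] by simp
  have a: "bracket z (bracket x y) = - bracket (bracket x y) z"
    by (rule bracket_anticomm)
  have b: "bracket y (bracket z x) = - bracket (bracket z x) y"
    by (rule bracket_anticomm)
  have c: "bracket (bracket z x) y = - bracket (bracket x z) y"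
    by (subst bracket_anticomm[of z x]) (rule neg)
  show ?thesis unfolding leibniz[of x y z] a b c by simp
qed

lemma lie_algebra_jacobiI:
  fixes scale :: "'k::field \<Rightarrow> 'a::ab_group_add \<Rightarrow> 'a"
  assumes vs: "vector_space scale"
    and add_left: "\<And>x y z. bracket (x + y) z = bracket x z + bracket y z"
    and add_right: "\<And>x y z. bracket x (y + z) = bracket x y + bracket x z"
    and scale_left: "\<And>c x y. bracket (scale c x) y = scale c (bracket x y)"
    and scale_right: "\<And>c x y. bracket x (scale c y) = scale c (bracket x y)"
    and self: "\<And>x. bracket x x = 0"
    and jacobi: "\<And>x y z. bracket x (bracket y z) + bracket y (bracket z x) + bracket z (bracket x y) = 0"
  shows "lie_algebra scale bracket"
proof -
  interpret vector_space scale by (rule vs)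
  have anticomm: "bracket x y = - bracket y x" for x y
  proof -
    have "bracket (x + y) (x + y) = 0" by (rule self)
    then have "bracket x y + bracket y x = 0"
      unfolding add_left add_right by (simp add: self add.commute)
    then show ?thesis by (simp add: eq_neg_iff_add_eq_0)
  qed
  have neg: "bracket (- u) v = - bracket u v" for u v
    using scale_left[of "-1" u v] by simp
  have leibniz: "bracket x (bracket y z) = bracket (bracket x y) z - bracket (bracket x z) y" for x y z
  proof -
    have a: "bracket z (bracket x y) = - bracket (bracket x y) z" by (rule anticomm)
    have b: "bracket y (bracket z x) = - bracket (bracket z x) y" by (rule anticomm)
    have c: "bracket (bracket z x) y = - bracket (bracket x z) y"
      by (subst anticomm[of z x]) (rule neg)
    show ?thesis using jacobi[of x y z] unfolding a b c
      by (simp add: algebra_simps)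
  qed
  show ?thesis
    by unfold_locales (rule add_left add_right scale_left scale_right leibniz self)+
qed

text \<open>The lattice operations are intersection and \<open>subalgebra_join\<close>; outside of the
  subalgebras the values of \<open>\<theta>\<close> are irrelevant.\<close>

definition lattice_isomorphism ::
  "('k::field \<Rightarrow> 'a::ab_group_add \<Rightarrow> 'a) \<Rightarrow> ('a \<Rightarrow> 'a \<Rightarrow> 'a) \<Rightarrow>
   ('k \<Rightarrow> 'b::ab_group_add \<Rightarrow> 'b) \<Rightarrow> ('b \<Rightarrow> 'b \<Rightarrow> 'b) \<Rightarrow> ('a set \<Rightarrow> 'b set) \<Rightarrow> bool" where
  "lattice_isomorphism s br s' br' \<theta> \<longleftrightarrow>
     bij_betw \<theta> (leibniz_algebra.subalgebras s br) (leibniz_algebra.subalgebras s' br') \<and>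
     (\<forall>A \<in> leibniz_algebra.subalgebras s br. \<forall>B \<in> leibniz_algebra.subalgebras s br.
        \<theta> (leibniz_algebra.subalgebra_join s br A B) =
          leibniz_algebra.subalgebra_join s' br' (\<theta> A) (\<theta> B) \<and>
        \<theta> (A \<inter> B) = \<theta> A \<inter> \<theta> B)"

end

theory Submission imports Defs begin

text \<open>Let \<open>[x,x] \<noteq> 0\<close>, let \<open>R\<close> be right multiplication by \<open>x\<close>, let \<open>C\<close> be the span of all
  \<open>R\<^sup>n x\<close> and put \<open>K = R(C)\<close>. Then \<open>[C,K] = 0\<close> and \<open>K\<close> is a proper nonzero subalgebra of \<open>C\<close>.
  A minimal subalgebra of \<open>C\<close> outside \<open>K\<close> is spanned by some \<open>y = x + R s x\<close> with \<open>R y = 0\<close> and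
  \<open>s\<close> a polynomial in \<open>R\<close>; since such polynomials commute, \<open>(1 + R s') y = y\<close> for every \<open>s'\<close>
  forces \<open>y\<close> to be unique. So at most one minimal subalgebra below \<open>C\<close> is not below \<open>K\<close>.
  In a Lie algebra every nonzero vector spans a minimal subalgebra, so for subalgebras
  \<open>0 \<noteq> K' \<subset> C'\<close> one finds two: the spans of \<open>u\<close> and \<open>u + k\<close>, with \<open>u \<in> C' - K'\<close> and
  \<open>0 \<noteq> k \<in> K'\<close>.\<close>

context leibniz_algebra
begin

section \<open>Linearity of the product and elements annihilating from the right\<close>

sublocale self_pair: vector_space_pair scale scale ..

lemma linear_bracket_left: "Vector_Spaces.linear scale scale (\<lambda>u. bracket u x)"
  by unfold_locales (auto simp: bracket_add_left bracket_scale_left)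

lemma linear_bracket_right: "Vector_Spaces.linear scale scale (\<lambda>u. bracket x u)"
  by unfold_locales (auto simp: bracket_add_right bracket_scale_right)

lemma bracket_zero_left [simp]: "bracket 0 x = 0"
  using self_pair.linear_0[OF linear_bracket_left] .

lemma bracket_zero_right [simp]: "bracket x 0 = 0"
  using self_pair.linear_0[OF linear_bracket_right] .

text \<open>Each term of the Leibniz identity for \<open>bracket y (bracket z x)\<close> contains a
  product with right factor \<open>z\<close>. Hence right multiplication by \<open>x\<close>
  preserves the property of annihilating everything from the right.\<close>

lemma bracket_bracket_right_eq_0:
  assumes "\<And>y. bracket y z = 0"
  shows "bracket y (bracket z x) = 0"
  by (simp add: leibniz assms)

text \<open>For two equal inner factors the terms of the Leibniz identity cancel. This starts the
  induction showing that [C,K] = 0.\<close>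

lemma bracket_square_right: "bracket y (bracket x x) = 0"
  by (simp add: leibniz)

section \<open>One-dimensional and minimal subalgebras\<close>

lemma subalgebra_span_singleton:
  assumes "bracket y y = 0"
  shows "subalgebra (span {y})"
proof -
  have "bracket u v = 0" if "u \<in> span {y}" "v \<in> span {y}" for u v
    using that assms by (auto simp: span_singleton bracket_scale_left bracket_scale_right)
  then show ?thesis by (simp add: subalgebra_def span_zero)
qed

lemma subalgebra_zero: "subalgebra {0}"
  by (simp add: subalgebra_def)

lemma subalgebra_zero_mem: "subalgebra A \<Longrightarrow> 0 \<in> A"
  by (simp add: subalgebra_def subspace_0)

text \<open>These are the atoms of the subalgebra lattice. Only inclusion and the least element
  \<open>{0}\<close> enter, so the notion can be carried along a lattice isomorphism.\<close>

definition minimal_subalgebra :: "'a set \<Rightarrow> bool" where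
  "minimal_subalgebra S \<longleftrightarrow> subalgebra S \<and> S \<noteq> {0} \<and>
     (\<forall>T. subalgebra T \<longrightarrow> T \<subseteq> S \<longrightarrow> T = {0} \<or> T = S)"

lemma subspace_span_singleton_cases:
  assumes "subspace T" "T \<subseteq> span {y}"
  shows "T = {0} \<or> T = span {y}"
proof (cases "T \<subseteq> {0}")
  case True
  then show ?thesis using subspace_0[OF assms(1)] by blast
next
  case False
  then obtain t where t: "t \<in> T" "t \<noteq> 0" by blast
  then obtain c where c: "t = c *s y" using assms(2) by (auto simp: span_singleton)
  with t have "c \<noteq> 0" by auto
  then have "y = inverse c *s t" using c by simp
  then have "y \<in> T" using t(1) assms(1) subspace_scale by metis
  then have "span {y} \<subseteq> T" using assms(1) by (simp add: span_minimal)
  then show ?thesis using assms(2) by blast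
qed

lemma minimal_subalgebra_span_singleton:
  assumes "bracket y y = 0" "y \<noteq> 0"
  shows "minimal_subalgebra (span {y})"
proof -
  have "y \<in> span {y}" by (simp add: span_base)
  then show ?thesis
    using assms subalgebra_span_singleton subspace_span_singleton_cases
    unfolding minimal_subalgebra_def subalgebra_def by blast
qed

lemma minimal_subalgebra_eq_span:
  assumes "minimal_subalgebra S" "y \<in> S" "y \<noteq> 0" "bracket y y = 0"
  shows "S = span {y}"
proof -
  have "span {y} \<subseteq> S"
    using assms by (simp add: minimal_subalgebra_def subalgebra_def span_minimal)
  moreover have "span {y} \<noteq> {0}"
    using assms(3) span_base[of y "{y}"] by blast
  ultimately show ?thesis
    using assms subalgebra_span_singleton unfolding minimal_subalgebra_def by blast
qed

section \<open>The subalgebra generated by \<open>x\<close> and its derived algebra\<close>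

definition cyclic :: "'a \<Rightarrow> 'a set" where
  "cyclic x = span (range (\<lambda>n. ((\<lambda>u. bracket u x) ^^ n) x))"

text \<open>As [C,C] lies in [C,x], by \<open>bracket_mem_cyclic_derived\<close>, this image is the
  derived algebra of \<open>cyclic x\<close>.\<close>

definition cyclic_derived :: "'a \<Rightarrow> 'a set" where
  "cyclic_derived x = (\<lambda>u. bracket u x) ` cyclic x"

lemma self_mem_cyclic: "x \<in> cyclic x"
  unfolding cyclic_def by (rule span_base) (metis funpow_0 rangeI)

lemma subspace_cyclic: "subspace (cyclic x)"
  by (simp add: cyclic_def)

lemma subspace_cyclic_derived: "subspace (cyclic_derived x)"
  unfolding cyclic_derived_def
  by (rule self_pair.linear_subspace_image[OF linear_bracket_left subspace_cyclic])

lemma cyclic_derived_eq_span: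
  "cyclic_derived x = span (range (\<lambda>n. ((\<lambda>u. bracket u x) ^^ Suc n) x))"
  unfolding cyclic_derived_def cyclic_def
  by (simp add: self_pair.linear_span_image[OF linear_bracket_left, symmetric] image_image)

lemma cyclic_derived_subset: "cyclic_derived x \<subseteq> cyclic x"
  unfolding cyclic_derived_eq_span cyclic_def by (intro span_mono image_subsetI rangeI)

text \<open>The spanning family of C is that of K together with the power n = 0, which is
  \<open>x\<close> itself. So K has codimension at most one in C.\<close>

lemma cyclic_decompose:
  assumes "u \<in> cyclic x"
  obtains c k where "k \<in> cyclic_derived x" "u = c *s x + k"
proof -
  have "range (\<lambda>n. ((\<lambda>u. bracket u x) ^^ n) x)
      = insert x (range (\<lambda>n. ((\<lambda>u. bracket u x) ^^ Suc n) x))"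
    (is "_ = ?A")
  proof (intro equalityI image_subsetI)
    show "((\<lambda>u. bracket u x) ^^ n) x \<in> ?A" for n
      by (cases n) auto
    show "?A \<subseteq> range (\<lambda>n. ((\<lambda>u. bracket u x) ^^ n) x)"
      using rangeI[of "\<lambda>n. ((\<lambda>u. bracket u x) ^^ n) x" 0]
      by (auto simp del: funpow.simps(2))
  qed
  then obtain c where "u - c *s x \<in> cyclic_derived x"
    using assms unfolding cyclic_def cyclic_derived_eq_span span_breakdown_eq[of u x]
    by (auto simp: span_breakdown_eq simp del: funpow.simps)
  then show thesis using that[of "u - c *s x" c] by simp
qed

lemma bracket_cyclic_derived:
  assumes "k \<in> cyclic_derived x"
  shows "bracket y k = 0"
proof -
  have "bracket y (((\<lambda>u. bracket u x) ^^ Suc n) x) = 0" for n y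
    by (induction n arbitrary: y)
      (simp_all add: bracket_square_right bracket_bracket_right_eq_0)
  then have "cyclic_derived x \<subseteq> {k. bracket y k = 0}"
    unfolding cyclic_derived_eq_span
    by (intro span_minimal self_pair.linear_subspace_kernel[OF linear_bracket_right]) auto
  then show ?thesis using assms by blast
qed

text \<open>The K-component of the right factor contributes nothing, so multiplying by
  \<open>v\<close> from the right is a scalar multiple of multiplying by \<open>x\<close>.\<close>

lemma bracket_mem_cyclic_derived:
  assumes "u \<in> cyclic x" "v \<in> cyclic x"
  shows "bracket u v \<in> cyclic_derived x"
proof -
  obtain c k where "k \<in> cyclic_derived x" "v = c *s x + k"
    using cyclic_decompose[OF assms(2)] by metis
  then have "bracket u v = c *s bracket u x"
    by (simp add: bracket_add_right bracket_scale_right bracket_cyclic_derived)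
  then show ?thesis
    using assms(1) subspace_cyclic_derived subspace_scale by (auto simp: cyclic_derived_def)
qed

lemma subalgebra_cyclic: "subalgebra (cyclic x)"
  using subspace_cyclic bracket_mem_cyclic_derived cyclic_derived_subset
  unfolding subalgebra_def by blast

lemma subalgebra_cyclic_derived: "subalgebra (cyclic_derived x)"
  using subspace_cyclic_derived
  by (auto simp: subalgebra_def bracket_cyclic_derived subspace_0)

section \<open>Polynomials in right multiplication and uniqueness of the annihilated vector\<close>

text \<open>\<open>T\<close> stands for a polynomial in right multiplication by \<open>x\<close>; asking that it commute with
  everything that commutes with this operator makes any two such \<open>T\<close> commute with each other.\<close>

lemma cyclic_operator:
  assumes "u \<in> cyclic x"
  obtains T where "Vector_Spaces.linear scale scale T" "T x = u"
    "\<And>Q v. Vector_Spaces.linear scale scale Q \<Longrightarrow> (\<And>w. Q (bracket w x) = bracket (Q w) x) \<Longrightarrow>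
       T (Q v) = Q (T v)"
proof -
  let ?lin = "Vector_Spaces.linear scale scale"
  let ?R = "\<lambda>u. bracket u x"
  define good where "good T \<longleftrightarrow> ?lin T \<and>
    (\<forall>Q v. ?lin Q \<longrightarrow> (\<forall>w. Q (?R w) = ?R (Q w)) \<longrightarrow> T (Q v) = Q (T v))" for T
  have pow: "good (?R ^^ n)" for n
  proof (induction n)
    case 0
    show ?case by (simp add: good_def linear_id[unfolded id_def] id_def)
  next
    case (Suc n)
    then show ?case
      using Vector_Spaces.linear_compose[OF _ linear_bracket_left]
      by (auto simp: good_def comp_def)
  qed
  \<comment> \<open>The attainable values \<open>T x\<close> form a subspace; by \<open>pow\<close>
    it contains the spanning family of \<open>cyclic x\<close>.\<close>
  have "subspace {u. \<exists>T. good T \<and> T x = u}"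
  proof (rule subspaceI)
    have "good (\<lambda>_. 0)"
      by (auto simp: good_def self_pair.linear_0 self_pair.linear_zero)
    then show "0 \<in> {u. \<exists>T. good T \<and> T x = u}" by auto
  next
    fix a b assume "a \<in> {u. \<exists>T. good T \<and> T x = u}" "b \<in> {u. \<exists>T. good T \<and> T x = u}"
    then obtain S T where "good S" "S x = a" "good T" "T x = b" by auto
    moreover from this have "good (\<lambda>v. S v + T v)"
      by (auto simp: good_def self_pair.linear_add self_pair.linear_compose_add)
    ultimately show "a + b \<in> {u. \<exists>T. good T \<and> T x = u}" by force
  next
    fix c a assume "a \<in> {u. \<exists>T. good T \<and> T x = u}"
    then obtain T where "good T" "T x = a" by auto
    moreover from this have "good (\<lambda>v. c *s T v)"
      by (auto simp: good_def self_pair.linear_scale self_pair.linear_compose_scale_right)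
    ultimately show "c *s a \<in> {u. \<exists>T. good T \<and> T x = u}" by force
  qed
  then have "cyclic x \<subseteq> {u. \<exists>T. good T \<and> T x = u}"
    unfolding cyclic_def using pow by (intro span_minimal) auto
  with assms obtain T where "good T" "T x = u" by auto
  then show thesis using that unfolding good_def by blast
qed

text \<open>With \<open>k = ?R (S x)\<close> and \<open>k' = ?R (T x)\<close> for commuting
  \<open>S\<close> and \<open>T\<close>, both vectors turn out to equal
  \<open>- ?R (?R (S (T x)))\<close>.\<close>

lemma cyclic_annihilated_unique:
  assumes "k \<in> cyclic_derived x" "bracket (x + k) x = 0"
    and "k' \<in> cyclic_derived x" "bracket (x + k') x = 0"
  shows "k = k'"
proof -
  let ?lin = "Vector_Spaces.linear scale scale"
  let ?R = "\<lambda>u. bracket u x"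
  obtain u u' where u: "u \<in> cyclic x" "k = ?R u" "u' \<in> cyclic x" "k' = ?R u'"
    using assms by (auto simp: cyclic_derived_def)
  obtain S where S: "?lin S" "S x = u"
    "\<And>Q v. ?lin Q \<Longrightarrow> (\<And>w. Q (?R w) = ?R (Q w)) \<Longrightarrow> S (Q v) = Q (S v)"
    using cyclic_operator[OF u(1)] by metis
  obtain T where T: "?lin T" "T x = u'"
    "\<And>Q v. ?lin Q \<Longrightarrow> (\<And>w. Q (?R w) = ?R (Q w)) \<Longrightarrow> T (Q v) = Q (T v)"
    using cyclic_operator[OF u(3)] by metis
  have SR: "S (?R v) = ?R (S v)" and TR: "T (?R v) = ?R (T v)" for v
    using S(3) T(3) linear_bracket_left by blast+
  \<comment> \<open>\<open>T\<close> is itself one of the maps \<open>Q\<close> with which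
    \<open>S\<close> commutes, because \<open>TR\<close> says that it commutes with
    \<open>?R\<close>.\<close>
  have ST: "S (T v) = T (S v)" for v
    using S(3)[OF T(1)] TR by blast
  \<comment> \<open>Each annihilation equation is hit with the operator of the other vector; this
    expresses \<open>k'\<close> through \<open>T u\<close> and \<open>k\<close> through
    \<open>S u'\<close>.\<close>
  have "T (?R (x + k)) = 0" "S (?R (x + k')) = 0"
    using assms self_pair.linear_0 S(1) T(1) by auto
  then have "k' + ?R (?R (T u)) = 0" "k + ?R (?R (S u')) = 0"
    by (simp_all add: u SR TR bracket_add_left self_pair.linear_add S(1,2) T(1,2))
  moreover have "T u = S u'" using ST[of x] S(2) T(2) by simp
  ultimately show ?thesis by (metis add_right_imp_eq)
qed

text \<open>A vector of \<open>S\<close> outside K can be scaled to \<open>y = x + k\<close>. Its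
  square lies in K and has square zero, so a nonzero square would span \<open>S\<close> by
  minimality and force \<open>S\<close> into K.\<close>

lemma minimal_subalgebra_cyclic:
  assumes "minimal_subalgebra S" "S \<subseteq> cyclic x" "\<not> S \<subseteq> cyclic_derived x"
  obtains k where "k \<in> cyclic_derived x" "bracket (x + k) x = 0" "S = span {x + k}"
proof -
  have S: "subspace S" "\<And>a b. a \<in> S \<Longrightarrow> b \<in> S \<Longrightarrow> bracket a b \<in> S"
    using assms(1) by (auto simp: minimal_subalgebra_def subalgebra_def)
  obtain s where s: "s \<in> S" "s \<notin> cyclic_derived x" using assms(3) by blast
  obtain c k0 where k0: "k0 \<in> cyclic_derived x" "s = c *s x + k0"
    using cyclic_decompose s(1) assms(2) by blast
  with s have "c \<noteq> 0" by auto
  define k where "k = inverse c *s k0"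
  define y where "y = x + k"
  have k: "k \<in> cyclic_derived x"
    unfolding k_def using k0(1) subspace_cyclic_derived subspace_scale by blast
  have ys: "y = inverse c *s s"
    using \<open>c \<noteq> 0\<close> by (simp add: y_def k_def k0(2) scale_right_distrib)
  then have y: "y \<in> S" using s(1) S(1) subspace_scale by blast
  have "s = c *s y" using ys \<open>c \<noteq> 0\<close> by simp
  then have ynk: "y \<notin> cyclic_derived x"
    using s(2) subspace_cyclic_derived subspace_scale by blast
  have yy: "bracket y y = bracket y x"
    by (subst (2) y_def) (simp add: bracket_add_right bracket_cyclic_derived[OF k])
  have yyK: "bracket y y \<in> cyclic_derived x"
    using y assms(2) bracket_mem_cyclic_derived by blast
  have "bracket y y = 0"
  proof (rule ccontr)
    assume "bracket y y \<noteq> 0"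
    then have "S = span {bracket y y}"
      using assms(1) S(2) y bracket_cyclic_derived[OF yyK] by (intro minimal_subalgebra_eq_span) auto
    then have "S \<subseteq> cyclic_derived x"
      using yyK subspace_cyclic_derived by (simp add: span_minimal)
    then show False using assms(3) by blast
  qed
  moreover have "y \<noteq> 0" using ynk subspace_0[OF subspace_cyclic_derived] by blast
  ultimately show thesis
    using that[of k] k yy y minimal_subalgebra_eq_span[OF assms(1)] unfolding y_def by metis
qed

lemma minimal_subalgebra_cyclic_unique:
  assumes "minimal_subalgebra S" "S \<subseteq> cyclic x" "\<not> S \<subseteq> cyclic_derived x"
    and "minimal_subalgebra T" "T \<subseteq> cyclic x" "\<not> T \<subseteq> cyclic_derived x"
  shows "S = T"
  using minimal_subalgebra_cyclic[OF assms(1-3)] minimal_subalgebra_cyclic[OF assms(4-6)]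
    cyclic_annihilated_unique by metis

text \<open>The square of \<open>x\<close> is a nonzero element of K, while \<open>x\<close> in K
  would give \<open>bracket x x = 0\<close> by [C,K] = 0.\<close>

lemma cyclic_derived_nontrivial:
  assumes "bracket x x \<noteq> 0"
  shows "cyclic_derived x \<noteq> {0}" "\<not> cyclic x \<subseteq> cyclic_derived x"
  using assms self_mem_cyclic[of x] bracket_cyclic_derived[of x x x]
  by (auto simp: cyclic_derived_def)

end

section \<open>Minimal subalgebras of a Lie algebra\<close>

lemma (in lie_algebra) two_minimal_subalgebras:
  assumes "subalgebra C" "subalgebra K" "K \<subseteq> C" "K \<noteq> {0}" "\<not> C \<subseteq> K"
  obtains U V where "minimal_subalgebra U" "U \<subseteq> C" "\<not> U \<subseteq> K"
    and "minimal_subalgebra V" "V \<subseteq> C" "\<not> V \<subseteq> K" and "U \<noteq> V"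
proof -
  have C: "subspace C" and K: "subspace K"
    using assms by (auto simp: subalgebra_def)
  obtain u where u: "u \<in> C" "u \<notin> K" using assms by blast
  obtain k where k: "k \<in> K" "k \<noteq> 0" using assms(4) subspace_0[OF K] by blast
  have uk: "u + k \<in> C" "u + k \<notin> K"
    using u k assms(3) C K subspace_add subspace_diff[OF K, of "u + k" k] by auto
  have in_span: "v \<in> span {v}" for v by (simp add: span_base)
  \<comment> \<open>Equal lines would contain the difference \<open>k\<close>, hence coincide with
    \<open>span {k}\<close>, which lies in \<open>K\<close>; but \<open>u\<close> does not.\<close>
  have "span {u} \<noteq> span {u + k}"
  proof
    assume "span {u} = span {u + k}"
    then have "u + k - u \<in> span {u}" using in_span span_diff by metis
    then have "span {k} \<subseteq> span {u}" by (simp add: span_minimal)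
    then have "span {k} = span {u}"
      using subspace_span_singleton_cases[of "span {k}" u] in_span[of k] k(2) by auto
    then show False
      using in_span[of u] k(1) u(2) span_minimal[of "{k}" K] K by blast
  qed
  moreover have "minimal_subalgebra (span {v})" "span {v} \<subseteq> C" "\<not> span {v} \<subseteq> K"
    if "v \<in> C" "v \<notin> K" for v
    using that C subspace_0[OF K] in_span[of v]
    by (auto intro!: minimal_subalgebra_span_singleton bracket_self simp: span_minimal
        dest: span_minimal[of "{v}" C, THEN subsetD, rotated 2])
  ultimately show thesis using that u uk by metis
qed

section \<open>Transport of inclusion and minimality along a lattice isomorphism\<close>

lemma lattice_isomorphism_subset_iff:
  assumes "lattice_isomorphism s br s' br' \<theta>"
    and "A \<in> leibniz_algebra.subalgebras s br" "B \<in> leibniz_algebra.subalgebras s br"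
    and "leibniz_algebra s br"
  shows "\<theta> A \<subseteq> \<theta> B \<longleftrightarrow> A \<subseteq> B"
proof -
  interpret leibniz_algebra s br by fact
  have "A \<inter> B \<in> subalgebras"
    using assms(2,3) subalgebra_Int by (simp add: subalgebras_def)
  moreover have "\<theta> (A \<inter> B) = \<theta> A \<inter> \<theta> B" "inj_on \<theta> subalgebras"
    using assms(1-3) by (auto simp: lattice_isomorphism_def bij_betw_def)
  \<comment> \<open>Inclusion is encoded as \<open>A \<inter> B = A\<close>, an equation that
    \<open>\<theta>\<close> preserves and, by injectivity, reflects.\<close>
  ultimately show ?thesis
    using assms(2) by (metis inf.absorb_iff1 inj_onD)
qed

lemma lattice_isomorphism_minimal_iff:
  assumes iso: "lattice_isomorphism s br s' br' \<theta>"
    and L: "leibniz_algebra s br" and L': "leibniz_algebra s' br'"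
    and S: "S \<in> leibniz_algebra.subalgebras s br"
  shows "leibniz_algebra.minimal_subalgebra s' br' (\<theta> S) \<longleftrightarrow>
    leibniz_algebra.minimal_subalgebra s br S"
    and "\<theta> {0} = {0}"
proof -
  interpret A: leibniz_algebra s br by fact
  interpret B: leibniz_algebra s' br' by fact
  have bij: "bij_betw \<theta> A.subalgebras B.subalgebras"
    using iso by (simp add: lattice_isomorphism_def)
  note sub_iff = lattice_isomorphism_subset_iff[OF iso _ _ L]
  have zA: "{0} \<in> A.subalgebras" and zB: "{0} \<in> B.subalgebras"
    by (simp_all add: A.subalgebras_def B.subalgebras_def A.subalgebra_zero B.subalgebra_zero)
  \<comment> \<open>Surjectivity gives a preimage \<open>Z\<close> of the least subalgebra. Since
    \<open>{0} \<subseteq> Z\<close>, monotonicity puts \<open>\<theta> {0}\<close> inside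
    \<open>{0}\<close>.\<close>
  obtain Z where Z: "Z \<in> A.subalgebras" "\<theta> Z = {0}"
    using bij zB by (metis bij_betw_imp_surj_on imageE)
  have "{0} \<subseteq> Z" using Z(1) A.subalgebra_zero_mem by (simp add: A.subalgebras_def)
  then have "\<theta> {0} \<subseteq> {0}" using sub_iff[OF zA Z(1)] Z(2) by simp
  moreover have "\<theta> {0} \<in> B.subalgebras" using bij zA by (rule bij_betwE[THEN bspec])
  ultimately show zero: "\<theta> {0} = {0}"
    using B.subalgebra_zero_mem by (auto simp: B.subalgebras_def)
  have eq_iff: "\<theta> X = \<theta> Y \<longleftrightarrow> X = Y" if "X \<in> A.subalgebras" "Y \<in> A.subalgebras" for X Y
    using bij that by (meson bij_betw_def inj_on_eq_iff)
  \<comment> \<open>Writing every subalgebra of the target as an image lets the quantifier over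
    \<open>T\<close> in the definition of minimality be pulled back.\<close>
  have img: "B.subalgebras = \<theta> ` A.subalgebras"
    using bij by (simp add: bij_betw_def)
  have "B.minimal_subalgebra (\<theta> S) \<longleftrightarrow> \<theta> S \<in> B.subalgebras \<and> \<theta> S \<noteq> \<theta> {0} \<and>
      (\<forall>T\<in>B.subalgebras. T \<subseteq> \<theta> S \<longrightarrow> T = \<theta> {0} \<or> T = \<theta> S)"
    by (auto simp: B.minimal_subalgebra_def B.subalgebras_def zero)
  also have "\<dots> \<longleftrightarrow> S \<in> A.subalgebras \<and> S \<noteq> {0} \<and>
      (\<forall>T\<in>A.subalgebras. T \<subseteq> S \<longrightarrow> T = {0} \<or> T = S)"
    using S by (simp add: img sub_iff eq_iff zA)
  also have "\<dots> \<longleftrightarrow> A.minimal_subalgebra S"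
    by (auto simp: A.minimal_subalgebra_def A.subalgebras_def)
  finally show "B.minimal_subalgebra (\<theta> S) \<longleftrightarrow> A.minimal_subalgebra S" .
qed

theorem corollary2p2:
  fixes scale :: "'k::field \<Rightarrow> 'a::ab_group_add \<Rightarrow> 'a"
    and bracket :: "'a \<Rightarrow> 'a \<Rightarrow> 'a"
    and scale' :: "'k \<Rightarrow> 'b::ab_group_add \<Rightarrow> 'b"
    and bracket' :: "'b \<Rightarrow> 'b \<Rightarrow> 'b"
  assumes "leibniz_algebra scale bracket"
    and "\<exists>Basis. finite_dimensional_vector_space scale Basis"
    and "\<not> lie_algebra scale bracket"
    and "lie_algebra scale' bracket'"
    and "\<exists>Basis'. finite_dimensional_vector_space scale' Basis'"
  shows "\<not> (\<exists>\<theta>. lattice_isomorphism scale bracket scale' bracket' \<theta>)"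
proof
  assume "\<exists>\<theta>. lattice_isomorphism scale bracket scale' bracket' \<theta>"
  then obtain \<theta> where iso: "lattice_isomorphism scale bracket scale' bracket' \<theta>" ..
  interpret A: leibniz_algebra scale bracket by fact
  interpret B: lie_algebra scale' bracket' by fact
  have bij: "bij_betw \<theta> A.subalgebras B.subalgebras"
    using iso by (simp add: lattice_isomorphism_def)
  note sub_iff = lattice_isomorphism_subset_iff[OF iso _ _ assms(1)]
  note min_iff = lattice_isomorphism_minimal_iff[OF iso assms(1) B.leibniz_algebra_axioms]
  obtain x where x: "bracket x x \<noteq> 0"
    using assms(3) A.lie_algebra_iff by blast
  define C K where "C = A.cyclic x" and "K = A.cyclic_derived x"
  have C: "C \<in> A.subalgebras" and K: "K \<in> A.subalgebras"
    by (simp_all add: C_def K_def A.subalgebras_def A.subalgebra_cyclic A.subalgebra_cyclic_derived)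
  have Z: "{0} \<in> A.subalgebras" by (simp add: A.subalgebras_def A.subalgebra_zero)
  have "\<theta> K \<noteq> \<theta> {0}"
    using bij K Z A.cyclic_derived_nontrivial(1)[OF x]
    by (metis K_def bij_betw_imp_inj_on inj_onD)
  then have K0: "\<theta> K \<noteq> {0}" using min_iff(2)[OF C] by simp
  have CK: "B.subalgebra (\<theta> C)" "B.subalgebra (\<theta> K)"
    using bij C K bij_betwE by (fastforce simp: B.subalgebras_def)+
  have KC: "\<theta> K \<subseteq> \<theta> C" "\<not> \<theta> C \<subseteq> \<theta> K"
    using sub_iff[OF K C] sub_iff[OF C K] A.cyclic_derived_subset
      A.cyclic_derived_nontrivial(2)[OF x] by (auto simp: C_def K_def)
  obtain U V where UV: "B.minimal_subalgebra U" "U \<subseteq> \<theta> C" "\<not> U \<subseteq> \<theta> K"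
    "B.minimal_subalgebra V" "V \<subseteq> \<theta> C" "\<not> V \<subseteq> \<theta> K" "U \<noteq> V"
    using B.two_minimal_subalgebras[OF CK KC(1) K0 KC(2)] by blast
  then have "U \<in> B.subalgebras" "V \<in> B.subalgebras"
    by (auto simp: B.minimal_subalgebra_def B.subalgebras_def)
  \<comment> \<open>The two distinct minimal subalgebras found on the Lie side are pulled back,
    where uniqueness identifies their preimages.\<close>
  then obtain S T where ST: "S \<in> A.subalgebras" "U = \<theta> S" "T \<in> A.subalgebras" "V = \<theta> T"
    using bij by (metis bij_betw_imp_surj_on imageE)
  have "S = T"
  proof (rule A.minimal_subalgebra_cyclic_unique)
    show "A.minimal_subalgebra S" "A.minimal_subalgebra T"
      using UV ST min_iff(1) by auto
    show "S \<subseteq> A.cyclic x" "\<not> S \<subseteq> A.cyclic_derived x" "T \<subseteq> A.cyclic x" "\<not> T \<subseteq> A.cyclic_derived x"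
      using UV ST sub_iff C K unfolding C_def K_def by auto
  qed
  then show False using UV(7) ST by simp
qed

end
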